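(* Let $(V,\mathcal B,\nu)$ be a measure space with finite or $\sigma$-finite measure. Suppose $P$ is a Markov operator on $L^2(\nu)$ defined by an irreducible symmetric measure $\rho$ according to $P(f)(x)=\frac1{c(x)}\int_V f(y)\,d\rho_x(y)$. Then $$L^2(\nu)\cap\mathcal{H}arm(P)=\begin{cases}0, & \nu(V)=\infty,\\ \mathbb R\mathbb 1, & \nu(V)<\infty,\end{cases}$$ where $\mathbb R\mathbb 1$ is the set of constant functions. Moreover, $1$ does not belong to the point spectrum of the operator $P$ on the space $L^2(\nu)$.
   Context: $(V,\mathcal B,\mu)$ is a standard Borel space with a non-atomic $\sigma$-finite measure $\mu$. $\rho$ is a $\sigma$-finite symmetric measure on $(V\times V,\mathcal B\times\mathcal B)$, i.e. $\rho(A\times B)=\rho(B\times A)$ for all $A,B\in\mathcal B$, supported by a symmetric Borel set $E\subset V\times V$, and disintegrated with respect to $\mu$: there is a measurable family $x\mapsto\rho_x$ of measures on $(V,\mathcal B)$, with $\rho_x$ supported by $E_x=\{y:(x,y)\in E\}$, such that $\iint f\,d\rho=\int_V\big(\int_V f(x,y)\,d\rho_x(y)\big)d\mu(x)$. The measure $\rho$ is called irreducible if, for $\mu$-a.e. $x$, $E_x$ is nonempty, $E_x$ with its induced Borel structure is an uncountable standard Borel space, and $(E_x,\rho_x)$ is a standard (non-atomic) measure space. Put $c(x)=\rho_x(V)$; it is assumed that $0<c(x)<\infty$ for $\mu$-a.e. $x$ and $\int_A c\,d\mu<\infty$ whenever $\mu(A)<\infty$. The measure $\nu$ is $d\nu(x)=c(x)\,d\mu(x)$.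 $\mathcal{H}arm(P)=\{f:P(f)=f\}$ is the set of harmonic functions for $P$.
   Formalization: Irreducibility of ρ additionally means that every set of positive measure is reached from a.e. point by iterating ρ_x (the fibrewise definition alone makes the claim false); that 1 is not in the point spectrum is claimed only for ν(V)=∞, since constants are eigenfunctions when 0<ν(V)<∞. *)

theory Defs
  imports "HOL-Analysis.Analysis"
begin

text \<open>Polishness is stated with an abstract topology on the carrier, so that the notion also
  applies to Borel subspaces, in particular to the sections of a Borel set.\<close>

definition standard_borel_space :: "'a measure \<Rightarrow> bool" where
  "standard_borel_space M \<longleftrightarrow>
     (\<exists>T. topspace T = space M \<and> completely_metrizable_space T \<and> second_countable T \<and>
          sets M = sigma_sets (space M) {U. openin T U})"

definition nonatomic_measure :: "'a measure \<Rightarrow> bool" where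
  "nonatomic_measure M \<longleftrightarrow>
     (\<forall>A\<in>sets M. emeasure M A > 0 \<longrightarrow>
        (\<exists>B\<in>sets M. B \<subseteq> A \<and> 0 < emeasure M B \<and> emeasure M B < emeasure M A))"

definition standard_measure_space :: "'a measure \<Rightarrow> bool" where
  "standard_measure_space M \<longleftrightarrow>
     standard_borel_space M \<and> sigma_finite_measure M \<and> nonatomic_measure M"

text \<open>Throughout, \<open>V\<close> is \<open>space \<mu>\<close> and \<open>k x\<close> is the fibre measure $\rho_x$.\<close>

definition symmetric_measure :: "'v measure \<Rightarrow> ('v \<times> 'v) measure \<Rightarrow> bool" where
  "symmetric_measure \<mu> \<rho> \<longleftrightarrow>
     sets \<rho> = sets (\<mu> \<Otimes>\<^sub>M \<mu>) \<and> sigma_finite_measure \<rho> \<and>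
     (\<forall>A\<in>sets \<mu>. \<forall>B\<in>sets \<mu>. emeasure \<rho> (A \<times> B) = emeasure \<rho> (B \<times> A))"

definition supported_by_symmetric_set ::
  "'v measure \<Rightarrow> ('v \<times> 'v) measure \<Rightarrow> ('v \<times> 'v) set \<Rightarrow> bool" where
  "supported_by_symmetric_set \<mu> \<rho> E \<longleftrightarrow>
     E \<in> sets (\<mu> \<Otimes>\<^sub>M \<mu>) \<and> sym E \<and> emeasure \<rho> (space (\<mu> \<Otimes>\<^sub>M \<mu>) - E) = 0"

definition fibre :: "('v \<times> 'v) set \<Rightarrow> 'v \<Rightarrow> 'v set" where
  "fibre E x = {y. (x, y) \<in> E}"

definition disintegration ::
  "'v measure \<Rightarrow> ('v \<times> 'v) measure \<Rightarrow> ('v \<times> 'v) set \<Rightarrow> ('v \<Rightarrow> 'v measure) \<Rightarrow> bool" where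
  "disintegration \<mu> \<rho> E k \<longleftrightarrow>
     (\<forall>x\<in>space \<mu>. sets (k x) = sets \<mu>) \<and>
     (\<forall>A\<in>sets \<mu>. (\<lambda>x. emeasure (k x) A) \<in> borel_measurable \<mu>) \<and>
     (\<forall>x\<in>space \<mu>. emeasure (k x) (space \<mu> - fibre E x) = 0) \<and>
     (\<forall>f \<in> borel_measurable (\<mu> \<Otimes>\<^sub>M \<mu>).
        (\<integral>\<^sup>+ z. f z \<partial>\<rho>) = (\<integral>\<^sup>+ x. (\<integral>\<^sup>+ y. f (x, y) \<partial>(k x)) \<partial>\<mu>))"

definition irreducible_measure ::
  "'v measure \<Rightarrow> ('v \<times> 'v) set \<Rightarrow> ('v \<Rightarrow> 'v measure) \<Rightarrow> bool" where
  "irreducible_measure \<mu> E k \<longleftrightarrow>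
     (AE x in \<mu>. fibre E x \<noteq> {} \<and> uncountable (fibre E x) \<and>
        standard_measure_space (restrict_space (k x) (fibre E x)))"

text \<open>Iterates of the kernel: $\rho_x^{0}(A) = 1_A(x)$ and
  $\rho_x^{n+1}(A) = \int \rho_y^{n}(A)\, d\rho_x(y)$.\<close>

primrec kernel_iter :: "('v \<Rightarrow> 'v measure) \<Rightarrow> nat \<Rightarrow> 'v \<Rightarrow> 'v set \<Rightarrow> ennreal" where
  "kernel_iter k 0 x A = indicator A x"
| "kernel_iter k (Suc n) x A = (\<integral>\<^sup>+ y. kernel_iter k n y A \<partial>(k x))"

text \<open>Irreducibility of the kernel in the sense of Markov chains: every set of positive measure is
  reachable from almost every point. This does not follow from \<^const>\<open>irreducible_measure\<close>, which
  only concerns single fibres: if \<open>V\<close> is a disjoint union of two copies of $[0,1]$ and \<open>\<rho>\<close> is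
  Lebesgue measure on the two diagonal blocks, then \<^const>\<open>irreducible_measure\<close> holds, but the
  indicator function of either copy is harmonic.\<close>

definition irreducible_kernel :: "'v measure \<Rightarrow> ('v \<Rightarrow> 'v measure) \<Rightarrow> bool" where
  "irreducible_kernel \<mu> k \<longleftrightarrow>
     (\<forall>A\<in>sets \<mu>. emeasure \<mu> A > 0 \<longrightarrow> (AE x in \<mu>. \<exists>n. kernel_iter k n x A > 0))"

definition total_conductance :: "('v \<Rightarrow> 'v measure) \<Rightarrow> 'v \<Rightarrow> ennreal" where
  "total_conductance k x = emeasure (k x) (space (k x))"

definition conductance_measure :: "'v measure \<Rightarrow> ('v \<Rightarrow> 'v measure) \<Rightarrow> 'v measure" where
  "conductance_measure \<mu> k = density \<mu> (total_conductance k)"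

definition markov_op :: "('v \<Rightarrow> 'v measure) \<Rightarrow> ('v \<Rightarrow> real) \<Rightarrow> 'v \<Rightarrow> real" where
  "markov_op k f x = (1 / enn2real (total_conductance k x)) * (\<integral>y. f y \<partial>(k x))"

text \<open>Elements of $L^2(\nu)$ are represented by square-integrable functions, equality being equality
  almost everywhere. Accordingly all sets of functions below are saturated under almost everywhere
  equality, and \<open>P f = f\<close> is read almost everywhere.\<close>

definition L2_fun :: "'v measure \<Rightarrow> ('v \<Rightarrow> real) set" where
  "L2_fun \<nu> = {f \<in> borel_measurable \<nu>. integrable \<nu> (\<lambda>x. (f x)\<^sup>2)}"

text \<open>The integrability clause says that \<open>P f\<close> is defined almost everywhere; without it the library
  integral would return 0 for a non-integrable \<open>f\<close>.\<close>

definition harmonic :: "'v measure \<Rightarrow> ('v \<Rightarrow> 'v measure) \<Rightarrow> ('v \<Rightarrow> real) set" where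
  "harmonic \<nu> k = {f \<in> borel_measurable \<nu>.
     (AE x in \<nu>. integrable (k x) f) \<and> (AE x in \<nu>. markov_op k f x = f x)}"

definition zero_funs :: "'v measure \<Rightarrow> ('v \<Rightarrow> real) set" where
  "zero_funs \<nu> = {f \<in> borel_measurable \<nu>. AE x in \<nu>. f x = 0}"

definition constant_funs :: "'v measure \<Rightarrow> ('v \<Rightarrow> real) set" where
  "constant_funs \<nu> = {f \<in> borel_measurable \<nu>. \<exists>a. AE x in \<nu>. f x = a}"

definition L2_point_spectrum ::
  "'v measure \<Rightarrow> (('v \<Rightarrow> real) \<Rightarrow> 'v \<Rightarrow> real) \<Rightarrow> real set" where
  "L2_point_spectrum \<nu> T =
     {s. \<exists>f\<in>L2_fun \<nu>. \<not> (AE x in \<nu>. f x = 0) \<and> (AE x in \<nu>. T f x = s * f x)}"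

end

theory Submission
  imports Defs
begin

text \<open>
  A harmonic function in \<open>L\<^sup>2(\<nu>)\<close> has Dirichlet energy zero. Symmetry of \<open>\<rho>\<close> makes \<open>\<nu>\<close> both marginals
  of \<open>\<rho>\<close>, so expanding the square gives
  \<open>\<integral> (f(x) - f(y))\<^sup>2 d\<rho> = 2 \<integral> f\<^sup>2 d\<nu> - 2 \<integral> f \<cdot> P f d\<nu>\<close>, which vanishes when \<open>P f = f\<close>.

  Hence \<open>f(x) = f(y)\<close> for \<open>\<rho>\<close>-almost every edge: from almost every point where \<open>f \<le> q\<close>, one step
  of the kernel cannot lead to \<open>{f > q}\<close>, and neither can any number of steps, because null
  sets are not charged by almost every fibre measure. Irreducibility of the kernel says
  that a set of positive measure is reached from almost every point, so each superlevel set is null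
  or conull, and running over rational \<open>q\<close> shows that \<open>f\<close> is constant almost everywhere.

  Conversely constants are harmonic, and a nonzero constant is square integrable exactly if
  \<open>\<nu>(V) < \<infinity>\<close>. For the point spectrum, an \<open>L\<^sup>2\<close> eigenfunction for the eigenvalue 1 is harmonic
  because square-integrable functions are integrable on almost every fibre.
\<close>

section \<open>Products and squares of reals in terms of positive and negative parts\<close>

lemma ennreal_minus_mult:
  "ennreal (- (a * b)) = ennreal a * ennreal (- b) + ennreal (- a) * ennreal b" for a b :: real
proof -
  consider "0 \<le> a" "0 \<le> b" | "0 \<le> a" "b \<le> 0" | "a \<le> 0" "0 \<le> b" | "a \<le> 0" "b \<le> 0"
    by linarith
  then show ?thesis
  proof cases
    case 1 then show ?thesis by (simp add: ennreal_neg)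
  next
    case 2 then show ?thesis by (simp add: ennreal_neg flip: ennreal_mult)
  next
    case 3 then show ?thesis by (simp add: ennreal_neg flip: ennreal_mult)
  next
    case 4 then show ?thesis by (simp add: ennreal_neg mult_nonpos_nonpos)
  qed
qed

text \<open>The identity \<open>(a - b)\<^sup>2 + 2ab = a\<^sup>2 + b\<^sup>2\<close> with \<open>ab\<close> split into its positive and negative
  parts, so that no subtraction occurs and both sides can be integrated in \<open>[0, \<infinity>]\<close>.\<close>

lemma ennreal_power2_diff_parts:
  "ennreal ((a - b)\<^sup>2) + 2 * ennreal (a * b) =
    ennreal (a\<^sup>2) + ennreal (b\<^sup>2) + 2 * ennreal (- (a * b))" for a b :: real
proof (cases "0 \<le> a * b")
  case True
  have "ennreal ((a - b)\<^sup>2) + 2 * ennreal (a * b) = ennreal ((a - b)\<^sup>2 + 2 * (a * b))"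
    using True by (simp add: ennreal_mult)
  also have "(a - b)\<^sup>2 + 2 * (a * b) = a\<^sup>2 + b\<^sup>2"
    by (simp add: power2_eq_square algebra_simps)
  finally show ?thesis
    using True by (simp add: ennreal_neg)
next
  case False
  define p where "p = - (a * b)"
  have "0 \<le> p"
    using False by (simp add: p_def)
  have "ennreal (a\<^sup>2) + ennreal (b\<^sup>2) + 2 * ennreal p = ennreal (a\<^sup>2 + b\<^sup>2 + 2 * p)"
    using \<open>0 \<le> p\<close> by (simp add: ennreal_mult)
  also have "a\<^sup>2 + b\<^sup>2 + 2 * p = (a - b)\<^sup>2"
    by (simp add: p_def power2_eq_square algebra_simps)
  finally show ?thesis
    using False by (simp add: ennreal_neg p_def)
qed

section \<open>Symmetric kernels\<close>

locale symmetric_kernel =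
  fixes \<mu> :: "'v measure" and \<rho> :: "('v \<times> 'v) measure" and k :: "'v \<Rightarrow> 'v measure"
  assumes sets_rho: "sets \<rho> = sets (\<mu> \<Otimes>\<^sub>M \<mu>)"
    and rho_swap: "\<And>A B. A \<in> sets \<mu> \<Longrightarrow> B \<in> sets \<mu> \<Longrightarrow>
      emeasure \<rho> (A \<times> B) = emeasure \<rho> (B \<times> A)"
    and sets_k: "\<And>x. x \<in> space \<mu> \<Longrightarrow> sets (k x) = sets \<mu>"
    and measurable_emeasure_k:
      "\<And>A. A \<in> sets \<mu> \<Longrightarrow> (\<lambda>x. emeasure (k x) A) \<in> borel_measurable \<mu>"
    and nn_integral_rho: "\<And>f. f \<in> borel_measurable (\<mu> \<Otimes>\<^sub>M \<mu>) \<Longrightarrow>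
      (\<integral>\<^sup>+ z. f z \<partial>\<rho>) = (\<integral>\<^sup>+ x. (\<integral>\<^sup>+ y. f (x, y) \<partial>(k x)) \<partial>\<mu>)"
    and conductance_pos_finite:
      "AE x in \<mu>. 0 < total_conductance k x \<and> total_conductance k x < \<infinity>"
begin

abbreviation c :: "'v \<Rightarrow> ennreal" where "c \<equiv> total_conductance k"

abbreviation \<nu> :: "'v measure" where "\<nu> \<equiv> conductance_measure \<mu> k"

lemma space_k: "x \<in> space \<mu> \<Longrightarrow> space (k x) = space \<mu>"
  using sets_k sets_eq_imp_space_eq by blast

lemma measurable_k: "x \<in> space \<mu> \<Longrightarrow> h \<in> measurable \<mu> N \<Longrightarrow> h \<in> measurable (k x) N"
  using measurable_cong_sets[OF sets_k refl] by blast

lemma measurable_rho: "measurable \<rho> N = measurable (\<mu> \<Otimes>\<^sub>M \<mu>) N"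
  using measurable_cong_sets[OF sets_rho refl] .

lemma measurable_conductance [measurable]: "c \<in> borel_measurable \<mu>"
proof -
  have "(\<lambda>x. emeasure (k x) (space \<mu>)) \<in> borel_measurable \<mu>"
    by (rule measurable_emeasure_k) simp
  then show ?thesis
    by (rule measurable_cong[THEN iffD1, rotated]) (simp add: total_conductance_def space_k)
qed

text \<open>The monotone class argument starts from the indicators of sets in \<open>\<mu>\<close>, for which the claim is the
  measurability of \<open>x \<mapsto> k\<^sub>x(A)\<close>.\<close>

lemma measurable_nn_integral_k [measurable]:
  fixes h :: "'v \<Rightarrow> ennreal"
  assumes "h \<in> borel_measurable \<mu>"
  shows "(\<lambda>x. \<integral>\<^sup>+ y. h y \<partial>(k x)) \<in> borel_measurable \<mu>"
  using assms
proof (induction rule: borel_measurable_induct)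
  case (cong f g)
  have "(\<integral>\<^sup>+ y. f y \<partial>(k x)) = (\<integral>\<^sup>+ y. g y \<partial>(k x))" if "x \<in> space \<mu>" for x
    by (rule nn_integral_cong) (use that cong in \<open>simp add: space_k\<close>)
  then show ?case
    using cong by (simp cong: measurable_cong)
next
  case (set A)
  then have "(\<lambda>x. emeasure (k x) A) \<in> borel_measurable \<mu>"
    by (rule measurable_emeasure_k)
  then show ?case
    by (rule measurable_cong[THEN iffD1, rotated]) (use set in \<open>simp add: sets_k\<close>)
next
  case (mult u a)
  then have "(\<lambda>x. a * (\<integral>\<^sup>+ y. u y \<partial>(k x))) \<in> borel_measurable \<mu>"
    by measurable
  then show ?case
    by (rule measurable_cong[THEN iffD1, rotated])
      (use mult in \<open>simp add: nn_integral_cmult measurable_k\<close>)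
next
  case (add u v)
  then have "(\<lambda>x. (\<integral>\<^sup>+ y. v y \<partial>(k x)) + (\<integral>\<^sup>+ y. u y \<partial>(k x))) \<in> borel_measurable \<mu>"
    by measurable
  then show ?case
    by (rule measurable_cong[THEN iffD1, rotated])
      (use add in \<open>simp add: nn_integral_add measurable_k\<close>)
next
  case (seq U)
  then have "(\<lambda>x. SUP i. \<integral>\<^sup>+ y. U i y \<partial>(k x)) \<in> borel_measurable \<mu>"
    by measurable
  then show ?case
    by (rule measurable_cong[THEN iffD1, rotated])
      (use seq in \<open>simp add: nn_integral_monotone_convergence_SUP measurable_k image_comp\<close>)
qed

lemma sets_nu [simp]: "sets \<nu> = sets \<mu>"
  by (simp add: conductance_measure_def)

lemma space_nu [simp]: "space \<nu> = space \<mu>"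
  by (simp add: conductance_measure_def)

lemma measurable_nu [simp]: "measurable \<nu> N = measurable \<mu> N"
  by (rule measurable_cong_sets) simp_all

text \<open>The density \<open>c\<close> is positive almost everywhere, so \<open>\<nu>\<close> and \<open>\<mu>\<close> have the same null sets.\<close>

lemma AE_nu_iff: "(AE x in \<nu>. Q x) \<longleftrightarrow> (AE x in \<mu>. Q x)"
proof -
  have "(AE x in \<nu>. Q x) \<longleftrightarrow> (AE x in \<mu>. 0 < c x \<longrightarrow> Q x)"
    unfolding conductance_measure_def by (rule AE_density) measurable
  also have "\<dots> \<longleftrightarrow> (AE x in \<mu>. Q x)"
    using conductance_pos_finite by (intro eventually_cong) (auto elim: eventually_mono)
  finally show ?thesis .
qed

lemma nn_integral_nu:
  "h \<in> borel_measurable \<mu> \<Longrightarrow> (\<integral>\<^sup>+ x. h x \<partial>\<nu>) = (\<integral>\<^sup>+ x. c x * h x \<partial>\<mu>)"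
  unfolding conductance_measure_def by (rule nn_integral_density) measurable

text \<open>Both marginals of \<open>\<rho>\<close> are \<open>\<nu>\<close>: the first by disintegration, the second by symmetry.\<close>

lemma nn_integral_rho_fst:
  fixes h :: "'v \<Rightarrow> ennreal"
  assumes [measurable]: "h \<in> borel_measurable \<mu>"
  shows "(\<integral>\<^sup>+ z. h (fst z) \<partial>\<rho>) = (\<integral>\<^sup>+ x. h x \<partial>\<nu>)"
proof -
  have "(\<integral>\<^sup>+ z. h (fst z) \<partial>\<rho>) = (\<integral>\<^sup>+ x. (\<integral>\<^sup>+ y. h x \<partial>(k x)) \<partial>\<mu>)"
    by (subst nn_integral_rho) simp_all
  also have "\<dots> = (\<integral>\<^sup>+ x. c x * h x \<partial>\<mu>)"
    by (simp add: total_conductance_def mult.commute)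
  finally show ?thesis
    by (simp add: nn_integral_nu)
qed

lemma nn_integral_rho_snd:
  fixes h :: "'v \<Rightarrow> ennreal"
  assumes [measurable]: "h \<in> borel_measurable \<mu>"
  shows "(\<integral>\<^sup>+ z. h (snd z) \<partial>\<rho>) = (\<integral>\<^sup>+ x. h x \<partial>\<nu>)"
proof -
  have [measurable]: "fst \<in> measurable \<rho> \<mu>" "snd \<in> measurable \<rho> \<mu>"
    by (simp_all add: measurable_rho)
  have space_rho: "space \<rho> = space \<mu> \<times> space \<mu>"
    using sets_eq_imp_space_eq[OF sets_rho] by (simp add: space_pair_measure)
  have "distr \<rho> \<mu> snd = distr \<rho> \<mu> fst"
  proof (rule measure_eqI)
    fix A assume "A \<in> sets (distr \<rho> \<mu> snd)"
    then have A: "A \<in> sets \<mu>"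
      by simp
    have "snd -` A \<inter> space \<rho> = space \<mu> \<times> A" "fst -` A \<inter> space \<rho> = A \<times> space \<mu>"
      using sets.sets_into_space[OF A] by (auto simp: space_rho)
    then show "emeasure (distr \<rho> \<mu> snd) A = emeasure (distr \<rho> \<mu> fst) A"
      using A rho_swap[of A "space \<mu>"] by (simp add: emeasure_distr)
  qed simp
  then have "(\<integral>\<^sup>+ z. h (snd z) \<partial>\<rho>) = (\<integral>\<^sup>+ z. h (fst z) \<partial>\<rho>)"
    using nn_integral_distr[of snd \<rho> \<mu> h] nn_integral_distr[of fst \<rho> \<mu> h] by simp
  then show ?thesis
    by (simp add: nn_integral_rho_fst)
qed

lemma nn_integral_k_invariant:
  fixes h :: "'v \<Rightarrow> ennreal"
  assumes [measurable]: "h \<in> borel_measurable \<mu>"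
  shows "(\<integral>\<^sup>+ x. (\<integral>\<^sup>+ y. h y \<partial>(k x)) \<partial>\<mu>) = (\<integral>\<^sup>+ x. h x \<partial>\<nu>)"
  using nn_integral_rho[of "\<lambda>z. h (snd z)"] by (simp add: nn_integral_rho_snd)

text \<open>A \<open>\<mu>\<close>-null set \<open>N\<close> is \<open>\<nu>\<close>-null, and \<open>\<integral> k\<^sub>x(N) d\<mu>(x) = \<nu>(N)\<close> by invariance.\<close>

lemma AE_AE_k:
  assumes "AE x in \<mu>. Q x"
  shows "AE x in \<mu>. AE y in k x. Q y"
proof -
  obtain N where N: "N \<in> sets \<mu>" "emeasure \<mu> N = 0" "{x \<in> space \<mu>. \<not> Q x} \<subseteq> N"
    using assms by (rule AE_E) auto
  have "AE x in \<mu>. x \<notin> N"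
    using N by (intro AE_not_in) auto
  then have "(\<integral>\<^sup>+ x. indicator N x \<partial>\<nu>) = 0"
    by (subst nn_integral_0_iff_AE) (use N in \<open>auto simp: AE_nu_iff\<close>)
  then have "(\<integral>\<^sup>+ x. (\<integral>\<^sup>+ y. indicator N y \<partial>(k x)) \<partial>\<mu>) = 0"
    using N by (simp add: nn_integral_k_invariant)
  then have "AE x in \<mu>. (\<integral>\<^sup>+ y. indicator N y \<partial>(k x)) = 0"
    by (subst (asm) nn_integral_0_iff_AE) (use N in \<open>auto intro!: measurable_nn_integral_k\<close>)
  then show ?thesis
    using AE_space
  proof eventually_elim
    case (elim x)
    then have "N \<in> null_sets (k x)"
      using N by (auto simp: sets_k null_sets_def)
    then show ?case
      using N(3) elim by (intro AE_I') (auto simp: space_k)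
  qed
qed

section \<open>Square-integrable functions\<close>

lemma L2_fun_iff:
  "f \<in> L2_fun \<nu> \<longleftrightarrow> f \<in> borel_measurable \<mu> \<and> (\<integral>\<^sup>+ x. ennreal ((f x)\<^sup>2) \<partial>\<nu>) < \<infinity>"
  by (auto simp: L2_fun_def integrable_iff_bounded)

text \<open>Invariance of \<open>\<nu>\<close> gives \<open>\<integral>\<integral> f(y)\<^sup>2 dk\<^sub>x(y) d\<mu>(x) < \<infinity>\<close>, so almost every fibre integral of
  \<open>f\<^sup>2\<close> is finite; the fibre measures are finite, hence \<open>f\<close> is integrable on these fibres.\<close>

lemma AE_integrable_k:
  assumes "f \<in> L2_fun \<nu>"
  shows "AE x in \<mu>. integrable (k x) f"
proof -
  have [measurable]: "f \<in> borel_measurable \<mu>" and fin: "(\<integral>\<^sup>+ x. ennreal ((f x)\<^sup>2) \<partial>\<nu>) < \<infinity>"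
    using assms by (simp_all add: L2_fun_iff)
  have "(\<integral>\<^sup>+ x. (\<integral>\<^sup>+ y. ennreal ((f y)\<^sup>2) \<partial>(k x)) \<partial>\<mu>) < \<infinity>"
    using fin by (simp add: nn_integral_k_invariant)
  then have "AE x in \<mu>. (\<integral>\<^sup>+ y. ennreal ((f y)\<^sup>2) \<partial>(k x)) \<noteq> \<infinity>"
    by (intro nn_integral_PInf_AE) auto
  then show ?thesis
    using conductance_pos_finite AE_space
  proof eventually_elim
    case (elim x)
    have [measurable]: "f \<in> borel_measurable (k x)"
      using elim by (auto intro: measurable_k)
    \<comment> \<open>The constant 1 is integrable because \<open>k x\<close> is finite.\<close>
    have "norm (f y) \<le> 1 + (f y)\<^sup>2" for y
    proof -
      have "0 \<le> (\<bar>f y\<bar> - 1)\<^sup>2" by simp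
      then have "2 * \<bar>f y\<bar> \<le> 1 + (f y)\<^sup>2" by (simp add: power2_diff)
      then show ?thesis by simp
    qed
    then have "(\<integral>\<^sup>+ y. ennreal (norm (f y)) \<partial>(k x)) \<le> (\<integral>\<^sup>+ y. 1 + ennreal ((f y)\<^sup>2) \<partial>(k x))"
      by (intro nn_integral_mono) (simp add: ennreal_plus[symmetric] ennreal_1[symmetric]
          del: ennreal_plus ennreal_1)
    also have "\<dots> = c x + (\<integral>\<^sup>+ y. ennreal ((f y)\<^sup>2) \<partial>(k x))"
      by (simp add: nn_integral_add total_conductance_def)
    also have "\<dots> < \<infinity>"
      using elim by (simp add: less_top)
    finally show ?case
      by (simp add: integrable_iff_bounded)
  qed
qed

section \<open>The Dirichlet energy of a harmonic function\<close>

text \<open>This is \<open>\<integral> f(x) f(y) dk\<^sub>x(y) = c(x) f(x)\<^sup>2\<close>, that is \<open>P f = f\<close> multiplied by \<open>c(x) f(x)\<close>, with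
  the negative part of the integrand moved to the other side.\<close>

lemma harmonic_fibre_identity:
  assumes f [measurable]: "f \<in> borel_measurable \<mu>" and x: "x \<in> space \<mu>"
    and int: "integrable (k x) f" and Pf: "markov_op k f x = f x"
    and c: "0 < c x" "c x < \<infinity>"
  shows "(\<integral>\<^sup>+ y. ennreal (f x * f y) \<partial>(k x)) =
    (\<integral>\<^sup>+ y. ennreal (- (f x * f y)) \<partial>(k x)) + c x * ennreal ((f x)\<^sup>2)"
proof -
  let ?u = "\<integral>\<^sup>+ y. ennreal (f x * f y) \<partial>(k x)" and ?v = "\<integral>\<^sup>+ y. ennreal (- (f x * f y)) \<partial>(k x)"
  have int': "integrable (k x) (\<lambda>y. f x * f y)"
    using int by simp
  then have fin: "?u \<noteq> \<infinity>" "?v \<noteq> \<infinity>"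
    unfolding real_integrable_def by simp_all
  have c': "0 < enn2real (c x)" "ennreal (enn2real (c x)) = c x"
    using c by (auto simp: enn2real_positive_iff less_top)
  have "enn2real ?u - enn2real ?v = (\<integral>y. f x * f y \<partial>(k x))"
    by (rule real_lebesgue_integral_def[OF int', symmetric])
  also have "\<dots> = f x * (\<integral>y. f y \<partial>(k x))"
    by simp
  also have "(\<integral>y. f y \<partial>(k x)) = enn2real (c x) * f x"
    using Pf c' by (simp add: markov_op_def field_simps)
  finally have "enn2real ?u = enn2real ?v + enn2real (c x) * (f x)\<^sup>2"
    by (simp add: power2_eq_square algebra_simps)
  then have "ennreal (enn2real ?u) = ennreal (enn2real ?v) + ennreal (enn2real (c x)) * ennreal ((f x)\<^sup>2)"
    by (simp add: ennreal_mult)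
  then show ?thesis
    using fin c' by (simp add: less_top)
qed

text \<open>Write \<open>D\<close> for the energy, \<open>S\<close> for \<open>\<integral> f\<^sup>2 d\<nu>\<close>, and \<open>U\<close>, \<open>V\<close> for the integrals over \<open>\<rho>\<close> of the
  positive and negative parts of \<open>f(x) f(y)\<close>. Expanding the square gives \<open>D + 2 U = 2 S + 2 V\<close>,
  since both marginals of \<open>\<rho>\<close> are \<open>\<nu>\<close>; harmonicity gives \<open>U = V + S\<close>. As \<open>U \<le> 2 S < \<infinity>\<close>, the term
  \<open>2 U\<close> can be cancelled.\<close>

lemma harmonic_energy_zero:
  assumes f: "f \<in> L2_fun \<nu>" "f \<in> harmonic \<nu> k"
  shows "(\<integral>\<^sup>+ z. ennreal ((f (fst z) - f (snd z))\<^sup>2) \<partial>\<rho>) = 0"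
proof -
  have [measurable]: "f \<in> borel_measurable \<mu>" and fin: "(\<integral>\<^sup>+ x. ennreal ((f x)\<^sup>2) \<partial>\<nu>) < \<infinity>"
    using f by (simp_all add: L2_fun_iff)
  have [measurable]: "(\<lambda>z. f (fst z)) \<in> borel_measurable \<rho>" "(\<lambda>z. f (snd z)) \<in> borel_measurable \<rho>"
    by (simp_all add: measurable_rho)
  define D where "D = (\<integral>\<^sup>+ z. ennreal ((f (fst z) - f (snd z))\<^sup>2) \<partial>\<rho>)"
  define S where "S = (\<integral>\<^sup>+ x. ennreal ((f x)\<^sup>2) \<partial>\<nu>)"
  define U where "U = (\<integral>\<^sup>+ z. ennreal (f (fst z) * f (snd z)) \<partial>\<rho>)"
  define V where "V = (\<integral>\<^sup>+ z. ennreal (- (f (fst z) * f (snd z))) \<partial>\<rho>)"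
  have S1: "(\<integral>\<^sup>+ z. ennreal ((f (fst z))\<^sup>2) \<partial>\<rho>) = S"
    unfolding S_def by (rule nn_integral_rho_fst) measurable
  have S2: "(\<integral>\<^sup>+ z. ennreal ((f (snd z))\<^sup>2) \<partial>\<rho>) = S"
    unfolding S_def by (rule nn_integral_rho_snd) measurable
  have "D + 2 * U = (\<integral>\<^sup>+ z. ennreal ((f (fst z) - f (snd z))\<^sup>2) + 2 * ennreal (f (fst z) * f (snd z)) \<partial>\<rho>)"
    by (simp add: D_def U_def nn_integral_add nn_integral_cmult)
  also have "\<dots> = (\<integral>\<^sup>+ z. ennreal ((f (fst z))\<^sup>2) + ennreal ((f (snd z))\<^sup>2)
      + 2 * ennreal (- (f (fst z) * f (snd z))) \<partial>\<rho>)"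
    by (simp only: ennreal_power2_diff_parts)
  also have "\<dots> = S + S + 2 * V"
    by (simp add: V_def S1 S2 nn_integral_add nn_integral_cmult del: mult_minus_right)
  finally have energy: "D + 2 * U = S + S + 2 * V" .
  have "U = (\<integral>\<^sup>+ x. (\<integral>\<^sup>+ y. ennreal (f x * f y) \<partial>(k x)) \<partial>\<mu>)"
    unfolding U_def by (subst nn_integral_rho) simp_all
  also have "\<dots> = (\<integral>\<^sup>+ x. (\<integral>\<^sup>+ y. ennreal (- (f x * f y)) \<partial>(k x)) + c x * ennreal ((f x)\<^sup>2) \<partial>\<mu>)"
  proof (rule nn_integral_cong_AE)
    have "AE x in \<mu>. integrable (k x) f" "AE x in \<mu>. markov_op k f x = f x"
      using f(2) by (simp_all add: harmonic_def AE_nu_iff)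
    then show "AE x in \<mu>. (\<integral>\<^sup>+ y. ennreal (f x * f y) \<partial>(k x)) =
        (\<integral>\<^sup>+ y. ennreal (- (f x * f y)) \<partial>(k x)) + c x * ennreal ((f x)\<^sup>2)"
      using conductance_pos_finite AE_space
      by eventually_elim (simp add: harmonic_fibre_identity)
  qed
  also have "\<dots> = (\<integral>\<^sup>+ x. (\<integral>\<^sup>+ y. ennreal (- (f x * f y)) \<partial>(k x)) \<partial>\<mu>)
      + (\<integral>\<^sup>+ x. c x * ennreal ((f x)\<^sup>2) \<partial>\<mu>)"
  proof (rule nn_integral_add)
    \<comment> \<open>The inner integral depends on \<open>x\<close> also through its integrand; splitting the product into
      positive and negative parts of the factors brings \<open>f x\<close> in front of the integral.\<close>
    have "(\<lambda>x. ennreal (f x) * (\<integral>\<^sup>+ y. ennreal (- f y) \<partial>(k x))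
        + ennreal (- f x) * (\<integral>\<^sup>+ y. ennreal (f y) \<partial>(k x))) \<in> borel_measurable \<mu>"
      by measurable
    then show "(\<lambda>x. \<integral>\<^sup>+ y. ennreal (- (f x * f y)) \<partial>(k x)) \<in> borel_measurable \<mu>"
      by (rule measurable_cong[THEN iffD1, rotated])
        (simp add: ennreal_minus_mult nn_integral_add nn_integral_cmult measurable_k)
  qed measurable
  also have "\<dots> = V + S"
    unfolding V_def S_def by (subst nn_integral_rho) (simp_all add: nn_integral_nu)
  finally have US: "U = V + S" .
  have "U \<le> (\<integral>\<^sup>+ z. ennreal ((f (fst z))\<^sup>2) + ennreal ((f (snd z))\<^sup>2) \<partial>\<rho>)"
    unfolding U_def
  proof (rule nn_integral_mono)
    fix z
    have "f (fst z) * f (snd z) \<le> (f (fst z))\<^sup>2 + (f (snd z))\<^sup>2"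
    proof -
      have "2 * (f (fst z) * f (snd z)) \<le> (f (fst z))\<^sup>2 + (f (snd z))\<^sup>2"
        using sum_squares_bound[of "f (fst z)" "f (snd z)"] by simp
      moreover have "0 \<le> (f (fst z))\<^sup>2 + (f (snd z))\<^sup>2" by simp
      ultimately show ?thesis by linarith
    qed
    then show "ennreal (f (fst z) * f (snd z)) \<le> ennreal ((f (fst z))\<^sup>2) + ennreal ((f (snd z))\<^sup>2)"
      by (simp flip: ennreal_plus)
  qed
  also have "\<dots> = S + S"
    by (simp add: S1 S2 nn_integral_add)
  also have "\<dots> < \<infinity>"
    using fin by (simp add: S_def)
  finally have "2 * U < \<infinity>"
    by (simp add: ennreal_mult_less_top)
  moreover have "D + 2 * U = 2 * U"
    unfolding energy by (simp only: US mult_2 add.assoc add.commute add.left_commute)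
  ultimately have "D = 0"
    by (metis add.commute add.right_neutral ennreal_add_left_cancel infinity_ennreal_def less_irrefl)
  then show ?thesis
    by (simp add: D_def)
qed

section \<open>Irreducibility\<close>

text \<open>The hypothesis controls one step only from almost every starting point. The exceptional set is
  null, hence is avoided by the next step as well, which is what lets the induction go through.\<close>

lemma absorbing_complement_not_reached:
  assumes "AE x in \<mu>. x \<notin> A \<longrightarrow> (AE y in k x. y \<notin> A)"
  shows "AE x in \<mu>. x \<notin> A \<longrightarrow> kernel_iter k n x A = 0"
proof (induction n)
  case 0
  then show ?case by simp
next
  case (Suc n)
  show ?case
    using AE_AE_k[OF Suc.IH] assms
  proof eventually_elim
    case (elim x)
    show ?case
    proof
      assume "x \<notin> A"
      then have "AE y in k x. kernel_iter k n y A = 0"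
        using elim by (auto elim: AE_mp)
      then have "(\<integral>\<^sup>+ y. kernel_iter k n y A \<partial>(k x)) = (\<integral>\<^sup>+ y. 0 \<partial>(k x))"
        by (rule nn_integral_cong_AE)
      then show "kernel_iter k (Suc n) x A = 0"
        by simp
    qed
  qed
qed

lemma irreducible_zero_one:
  assumes irr: "irreducible_kernel \<mu> k" and A: "A \<in> sets \<mu>"
    and abs: "AE x in \<mu>. x \<notin> A \<longrightarrow> (AE y in k x. y \<notin> A)"
  shows "(AE x in \<mu>. x \<notin> A) \<or> (AE x in \<mu>. x \<in> A)"
proof (cases "emeasure \<mu> A = 0")
  case True
  then show ?thesis
    using A AE_not_in[of A \<mu>] by (simp add: null_sets_def)
next
  case False
  then have "emeasure \<mu> A > 0"
    by (simp add: zero_less_iff_neq_zero)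
  then have "AE x in \<mu>. \<exists>n. kernel_iter k n x A > 0"
    using irr A unfolding irreducible_kernel_def by blast
  moreover have "AE x in \<mu>. \<forall>n. x \<notin> A \<longrightarrow> kernel_iter k n x A = 0"
    unfolding AE_all_countable using absorbing_complement_not_reached[OF abs] by blast
  ultimately have "AE x in \<mu>. x \<in> A"
    by eventually_elim (metis less_irrefl)
  then show ?thesis ..
qed

text \<open>Zero energy forces \<open>f(x) = f(y)\<close> for \<open>\<rho>\<close>-almost every \<open>(x, y)\<close>, so \<open>\<rho>\<close> gives no mass to
  \<open>{f \<le> q} \<times> {f > q}\<close>. Disintegrating this rectangle gives the claim.\<close>

lemma AE_superlevel_absorbing:
  assumes [measurable]: "f \<in> borel_measurable \<mu>"
    and zero: "(\<integral>\<^sup>+ z. ennreal ((f (fst z) - f (snd z))\<^sup>2) \<partial>\<rho>) = 0"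
  shows "AE x in \<mu>. \<not> q < f x \<longrightarrow> (AE y in k x. \<not> q < f y)"
proof -
  define A where "A = {x \<in> space \<mu>. q < f x}"
  define B where "B = {x \<in> space \<mu>. \<not> q < f x}"
  have [measurable]: "A \<in> sets \<mu>" "B \<in> sets \<mu>"
    by (simp_all add: A_def B_def)
  have [measurable]: "(\<lambda>z. f (fst z)) \<in> borel_measurable \<rho>" "(\<lambda>z. f (snd z)) \<in> borel_measurable \<rho>"
    by (simp_all add: measurable_rho)
  have "AE z in \<rho>. ennreal ((f (fst z) - f (snd z))\<^sup>2) = 0"
    using zero by (subst (asm) nn_integral_0_iff_AE) simp_all
  then have "AE z in \<rho>. indicator B (fst z) * indicator A (snd z) = (0::ennreal)"
    by eventually_elim (auto simp: A_def B_def indicator_def)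
  then have "(\<integral>\<^sup>+ z. indicator B (fst z) * indicator A (snd z) \<partial>\<rho>) = (\<integral>\<^sup>+ z. (0::ennreal) \<partial>\<rho>)"
    by (rule nn_integral_cong_AE)
  then have "(\<integral>\<^sup>+ x. (\<integral>\<^sup>+ y. indicator B x * indicator A y \<partial>(k x)) \<partial>\<mu>) = 0"
    by (subst (asm) nn_integral_rho) simp_all
  also have "(\<integral>\<^sup>+ x. (\<integral>\<^sup>+ y. indicator B x * indicator A y \<partial>(k x)) \<partial>\<mu>) =
      (\<integral>\<^sup>+ x. indicator B x * emeasure (k x) A \<partial>\<mu>)"
    by (rule nn_integral_cong) (simp add: nn_integral_cmult_indicator sets_k)
  finally have "AE x in \<mu>. indicator B x * emeasure (k x) A = 0"
    by (subst (asm) nn_integral_0_iff_AE) (auto intro!: borel_measurable_times_ennreal measurable_emeasure_k)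
  then show ?thesis
    using AE_space
  proof eventually_elim
    case (elim x)
    show ?case
    proof
      assume "\<not> q < f x"
      then have "A \<in> null_sets (k x)"
        using elim by (auto simp: B_def null_sets_def sets_k)
      then show "AE y in k x. \<not> q < f y"
        using elim by (intro AE_I') (auto simp: A_def space_k)
    qed
  qed
qed

text \<open>The values of \<open>f\<close> at almost all points lie on the same side of each rational, hence agree.\<close>

lemma AE_constant_if_superlevel_trivial:
  fixes f :: "'v \<Rightarrow> real"
  assumes "\<And>q. (AE x in \<mu>. \<not> q < f x) \<or> (AE x in \<mu>. q < f x)"
  shows "\<exists>a. AE x in \<mu>. f x = a"
proof (cases "AE x in \<mu>. False")
  case True
  then have "AE x in \<mu>. f x = 0"
    by eventually_elim simp
  then show ?thesis ..
next
  case False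
  let ?good = "\<lambda>x. \<forall>q\<in>\<rat>. q < f x \<longleftrightarrow> (AE y in \<mu>. q < f y)"
  have "AE x in \<mu>. q < f x \<longleftrightarrow> (AE y in \<mu>. q < f y)" for q
    using assms[of q] by (cases "AE y in \<mu>. q < f y") auto
  then have good: "AE x in \<mu>. ?good x"
    by (simp add: AE_ball_countable countable_rat)
  have "\<exists>x. ?good x"
  proof (rule ccontr)
    assume "\<nexists>x. ?good x"
    then have "AE x in \<mu>. False"
      using good by (auto elim!: eventually_mono)
    then show False
      using False by simp
  qed
  then obtain x0 where x0: "?good x0" ..
  have "f x = f x0" if "?good x" for x
  proof (rule ccontr)
    assume "f x \<noteq> f x0"
    then consider "f x < f x0" | "f x0 < f x" by linarith
    then show False
    proof cases
      case 1
      then obtain q where "q \<in> \<rat>" "f x < q" "q < f x0"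
        using Rats_dense_in_real by blast
      then show False
        using x0 that by (metis less_asym)
    next
      case 2
      then obtain q where "q \<in> \<rat>" "f x0 < q" "q < f x"
        using Rats_dense_in_real by blast
      then show False
        using x0 that by (metis less_asym)
    qed
  qed
  with good have "AE x in \<mu>. f x = f x0"
    by (auto elim!: eventually_mono)
  then show ?thesis ..
qed

lemma harmonic_L2_constant:
  assumes "irreducible_kernel \<mu> k" "f \<in> L2_fun \<nu>" "f \<in> harmonic \<nu> k"
  shows "\<exists>a. AE x in \<mu>. f x = a"
proof (rule AE_constant_if_superlevel_trivial)
  fix q
  have f [measurable]: "f \<in> borel_measurable \<mu>"
    using assms by (simp add: L2_fun_iff)
  let ?A = "{x \<in> space \<mu>. q < f x}"
  have "AE x in \<mu>. x \<notin> ?A \<longrightarrow> (AE y in k x. y \<notin> ?A)"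
    using AE_superlevel_absorbing[OF f harmonic_energy_zero[OF assms(2,3)], of q] AE_space
    by eventually_elim auto
  then have "(AE x in \<mu>. x \<notin> ?A) \<or> (AE x in \<mu>. x \<in> ?A)"
    by (intro irreducible_zero_one assms) simp_all
  moreover have "(AE x in \<mu>. x \<notin> ?A) = (AE x in \<mu>. \<not> q < f x)"
    "(AE x in \<mu>. x \<in> ?A) = (AE x in \<mu>. q < f x)"
    by (rule AE_cong; simp)+
  ultimately show "(AE x in \<mu>. \<not> q < f x) \<or> (AE x in \<mu>. q < f x)"
    by simp
qed

section \<open>Constant functions\<close>

text \<open>Where \<open>f = a\<close> holds almost everywhere for \<open>k\<^sub>x\<close>, the quotient defining \<open>P f(x)\<close> is \<open>c(x) a / c(x)\<close>.\<close>

lemma constant_harmonic: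
  assumes f: "f \<in> borel_measurable \<mu>" and a: "AE x in \<mu>. f x = a"
  shows "f \<in> harmonic \<nu> k"
proof -
  have "AE x in \<mu>. integrable (k x) f \<and> markov_op k f x = f x"
    using AE_AE_k[OF a] a conductance_pos_finite AE_space
  proof eventually_elim
    case (elim x)
    have [measurable]: "f \<in> borel_measurable (k x)"
      using f elim by (auto intro: measurable_k)
    have c: "emeasure (k x) (space (k x)) < \<infinity>" "0 < emeasure (k x) (space (k x))"
      using elim by (auto simp: total_conductance_def)
    have "integrable (k x) (\<lambda>y. a)"
      using c by (intro finite_measure.integrable_const finite_measureI) auto
    then have int: "integrable (k x) f"
      by (rule integrable_cong_AE_imp) (use elim in auto)
    have "(\<integral>y. f y \<partial>(k x)) = (\<integral>y. a \<partial>(k x))"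
      using elim by (intro integral_cong_AE) auto
    also have "\<dots> = enn2real (c x) * a"
      by (simp add: total_conductance_def measure_def)
    finally show ?case
      using int elim c by (auto simp: markov_op_def total_conductance_def enn2real_eq_0_iff)
  qed
  then show ?thesis
    using f by (auto simp: harmonic_def AE_nu_iff)
qed

lemma constant_L2_iff:
  assumes f: "f \<in> borel_measurable \<mu>" and a: "AE x in \<mu>. f x = a"
  shows "f \<in> L2_fun \<nu> \<longleftrightarrow> a = 0 \<or> emeasure \<nu> (space \<nu>) < \<infinity>"
proof -
  have "(\<integral>\<^sup>+ x. ennreal ((f x)\<^sup>2) \<partial>\<nu>) = (\<integral>\<^sup>+ x. ennreal (a\<^sup>2) \<partial>\<nu>)"
    using a by (intro nn_integral_cong_AE) (auto simp: AE_nu_iff elim!: eventually_mono)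
  also have "\<dots> = ennreal (a\<^sup>2) * emeasure \<nu> (space \<nu>)"
    by (simp only: nn_integral_const)
  finally show ?thesis
    using f by (auto simp: L2_fun_iff ennreal_mult_less_top)
qed

lemma harmonic_L2_eq:
  assumes irr: "irreducible_kernel \<mu> k"
  shows "L2_fun \<nu> \<inter> harmonic \<nu> k =
    (if emeasure \<nu> (space \<nu>) = \<infinity> then zero_funs \<nu> else constant_funs \<nu>)"
proof -
  have "f \<in> L2_fun \<nu> \<inter> harmonic \<nu> k \<longleftrightarrow>
      f \<in> (if emeasure \<nu> (space \<nu>) = \<infinity> then zero_funs \<nu> else constant_funs \<nu>)" for f
  proof
    assume f: "f \<in> L2_fun \<nu> \<inter> harmonic \<nu> k"
    then obtain a where a: "AE x in \<mu>. f x = a"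
      using harmonic_L2_constant[OF irr] by blast
    have "f \<in> borel_measurable \<mu>"
      using f by (simp add: L2_fun_iff)
    then show "f \<in> (if emeasure \<nu> (space \<nu>) = \<infinity> then zero_funs \<nu> else constant_funs \<nu>)"
      using f a constant_L2_iff[of f a] by (auto simp: zero_funs_def constant_funs_def AE_nu_iff)
  next
    assume f: "f \<in> (if emeasure \<nu> (space \<nu>) = \<infinity> then zero_funs \<nu> else constant_funs \<nu>)"
    then have "f \<in> borel_measurable \<mu>"
      by (auto simp: zero_funs_def constant_funs_def split: if_splits)
    moreover obtain a where "AE x in \<mu>. f x = a" "a = 0 \<or> emeasure \<nu> (space \<nu>) < \<infinity>"
      using f by (auto simp: zero_funs_def constant_funs_def AE_nu_iff less_top split: if_splits)
    ultimately show "f \<in> L2_fun \<nu> \<inter> harmonic \<nu> k"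
      using constant_harmonic constant_L2_iff by blast
  qed
  then show ?thesis
    by blast
qed

end

theorem theorem4p7:
  fixes \<mu> :: "'v measure" and \<rho> :: "('v \<times> 'v) measure"
    and E :: "('v \<times> 'v) set" and k :: "'v \<Rightarrow> 'v measure"
  defines "\<nu> \<equiv> conductance_measure \<mu> k"
  assumes "standard_measure_space \<mu>"
    and "symmetric_measure \<mu> \<rho>"
    and "supported_by_symmetric_set \<mu> \<rho> E"
    and "disintegration \<mu> \<rho> E k"
    and "AE x in \<mu>. 0 < total_conductance k x \<and> total_conductance k x < \<infinity>"
    and "\<And>A. A \<in> sets \<mu> \<Longrightarrow> emeasure \<mu> A < \<infinity> \<Longrightarrow> (\<integral>\<^sup>+ x\<in>A. total_conductance k x \<partial>\<mu>) < \<infinity>"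
    and "sigma_finite_measure \<nu>"
    and "irreducible_measure \<mu> E k"
    and "irreducible_kernel \<mu> k"
  shows "L2_fun \<nu> \<inter> harmonic \<nu> k =
           (if emeasure \<nu> (space \<nu>) = \<infinity> then zero_funs \<nu> else constant_funs \<nu>)
       \<and> (emeasure \<nu> (space \<nu>) = \<infinity> \<longrightarrow> 1 \<notin> L2_point_spectrum \<nu> (markov_op k))"
proof -
  interpret symmetric_kernel \<mu> \<rho> k
    by unfold_locales
      (use assms in \<open>auto simp: symmetric_measure_def disintegration_def\<close>)
  have eq: "L2_fun \<nu> \<inter> harmonic \<nu> k =
      (if emeasure \<nu> (space \<nu>) = \<infinity> then zero_funs \<nu> else constant_funs \<nu>)"
    unfolding assms(1) by (rule harmonic_L2_eq) fact
  \<comment> \<open>An eigenfunction is only known to satisfy \<open>P f = f\<close>; its integrability on the fibres, which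
    harmonicity includes, comes from \<open>L\<^sup>2\<close>.\<close>
  moreover have "1 \<notin> L2_point_spectrum \<nu> (markov_op k)" if inf: "emeasure \<nu> (space \<nu>) = \<infinity>"
  proof
    assume "1 \<in> L2_point_spectrum \<nu> (markov_op k)"
    then obtain f where f: "f \<in> L2_fun \<nu>" "\<not> (AE x in \<nu>. f x = 0)"
      "AE x in \<nu>. markov_op k f x = f x"
      by (auto simp: L2_point_spectrum_def)
    have "AE x in \<nu>. integrable (k x) f"
      using AE_integrable_k f(1) unfolding assms(1) AE_nu_iff by blast
    then have "f \<in> harmonic \<nu> k"
      using f by (simp add: harmonic_def L2_fun_def)
    then have "f \<in> zero_funs \<nu>"
      using f(1) eq inf by auto
    then show False
      using f(2) by (simp add: zero_funs_def)
  qed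
  ultimately show ?thesis
    by blast
qed

end
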